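(* Let $p,q\in\mathbb{N}$ be co-prime and $\theta=\tan^{-1}(p/q)$. Then $$\mathcal{N}\Big(D,\big\{\tfrac{x+i}{2}: i\in D\big\}\Big)\le P(l_{pq},\sigma|_{l_{pq}},\phi).$$
   Context: Let $D=\{0,1,p/q\}$ with $p/q\in[0,1]$. For $a=a_1\cdots a_n\in D^n$ let $F_a$ be the composition $F_{a_1}\circ\cdots\circ F_{a_n}$ of the maps $F_i(x)=\frac{x+i}{2}$, $i\in D$. Let $\mathcal{N}_n(D)=\#\{(a,b)\in D^n\times D^n: F_a=F_b\}$ (equivalently $\sum_i a_i2^{-i}=\sum_i b_i2^{-i}$), and $\mathcal{N}(D,\{\frac{x+i}{2}:i\in D\})=\lim_{n\to\infty}\frac1n\log\mathcal{N}_n(D)$. Let $B=\{(0,0),(1,0),(0,1),(1,1)\}$ (elements written as column vectors), ordered in this way to index rows/columns $1,2,3,4$. Define the $4\times 4$ matrices $A_{(0,0)}=\begin{pmatrix}3&1&1&1\\0&1&0&0\\0&0&1&0\\0&0&0&1\end{pmatrix}$, $A_{(1,0)}=\begin{pmatrix}1&0&1&0\\1&3&0&1\\0&0&0&0\\0&0&1&1\end{pmatrix}$, $A_{(0,1)}=\begin{pmatrix}1&1&0&0\\0&0&0&0\\1&0&3&1\\0&1&0&1\end{pmatrix}$, $A_{(1,1)}=\begin{pmatrix}1&0&0&0\\0&1&0&0\\0&0&1&0\\1&1&1&3\end{pmatrix}$. For $z\in B^{\mathbb{N}}$ define $$\phi(z)=\limsup_{n\to\infty}\log\frac{(1,1,1,1)A_{z_1}A_{z_2}\cdots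 A_{z_n}(1,0,0,0)^T}{(1,1,1,1)A_{z_2}A_{z_3}\cdots A_{z_n}(1,0,0,0)^T}.$$ For a finite or infinite word $\omega$ over $B$ let $\pi(\omega)=\sum_i\omega_i2^{-i}\in\mathbb{R}^2$. The extended line is $l_\theta=l_{pq}=\{(x,y): \exists x',y' \text{ with } x\equiv x',\ y\equiv y' \pmod 1,\ \tfrac pq x'=y'\}$. Let $X_\theta^n=\{x\in B^n:\pi(x)\in l_\theta\}$ and $X_\theta^{\mathbb{N}}=\{\omega\in B^{\mathbb{N}}:\pi(\omega)\in l_\theta\}$, with left shift $\sigma$. For $i_1\cdots i_n\in X^n_\theta$ let $[i_1\cdots i_n]$ be the set of $\omega\in X^{\mathbb{N}}_\theta$ with $\omega_1\cdots\omega_n=i_1\cdots i_n$. The pressure is $$P(l_{pq},\sigma|_{l_{pq}},\phi)=P(X^{\mathbb{N}}_\theta,\sigma,\phi)=\lim_{n\to\infty}\frac1n\log\Big(\sum_{i_1\cdots i_n\in X^n_\theta}\exp\Big(\sup_{\omega\in[i_1\cdots i_n]}\sum_{j=0}^{n-1}\phi(\sigma^j\omega)\Big)\Big).$$ (Via the binary coding this is the pressure of $\phi$ for the doubling map $T(x,y)=(2x\bmod1,2y\bmod1)$ restricted to $l_{pq}$, also written $P(l_{pq},T|_{l_{pq}},\phi)$.) *)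

theory Defs
  imports Complex_Main "HOL-Library.Extended_Real" "HOL-Library.Liminf_Limsup"
begin

definition digitset :: "nat \<Rightarrow> nat \<Rightarrow> real set" where
  "digitset p q = {0, 1, real p / real q}"

definition Fmap :: "real \<Rightarrow> real \<Rightarrow> real" where
  "Fmap i x = (x + i) / 2"

definition Fcomp :: "real list \<Rightarrow> real \<Rightarrow> real" where
  "Fcomp a = foldr (\<lambda>i f. Fmap i \<circ> f) a id"

definition Ncount :: "real set \<Rightarrow> nat \<Rightarrow> nat" where
  "Ncount D n = card {(a, b). a \<in> {w. length w = n \<and> set w \<subseteq> D}
                        \<and> b \<in> {w. length w = n \<and> set w \<subseteq> D} \<and> Fcomp a = Fcomp b}"

definition Nexp :: "real set \<Rightarrow> real" where
  "Nexp D = lim (\<lambda>n. ln (real (Ncount D n)) / real n)"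

definition Bset :: "(nat \<times> nat) set" where
  "Bset = {(0,0), (1,0), (0,1), (1,1)}"

text \<open>Entries indexed by 0..3 (row i, column j), i.e. shifted by one from the paper.\<close>
definition Amat :: "nat \<times> nat \<Rightarrow> nat \<Rightarrow> nat \<Rightarrow> real" where
  "Amat b i j =
     (if b = (0,0) then [[3,1,1,1],[0,1,0,0],[0,0,1,0],[0,0,0,1]] ! i ! j
      else if b = (1,0) then [[1,0,1,0],[1,3,0,1],[0,0,0,0],[0,0,1,1]] ! i ! j
      else if b = (0,1) then [[1,1,0,0],[0,0,0,0],[1,0,3,1],[0,1,0,1]] ! i ! j
      else [[1,0,0,0],[0,1,0,0],[0,0,1,0],[1,1,1,3]] ! i ! j)"

definition vecmat :: "(nat \<Rightarrow> real) \<Rightarrow> (nat \<Rightarrow> nat \<Rightarrow> real) \<Rightarrow> nat \<Rightarrow> real" where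
  "vecmat v M j = (\<Sum>i<4. v i * M i j)"

definition Qprod :: "(nat \<times> nat) list \<Rightarrow> real" where
  "Qprod w = foldl (\<lambda>v b. vecmat v (Amat b)) (\<lambda>_. 1) w 0"

text \<open>phi(z); infinite words are 0-indexed: z 0 is the paper's z_1.
  The ratios lie in [2,3], so the limsup is a finite real.\<close>
definition phi :: "(nat \<Rightarrow> nat \<times> nat) \<Rightarrow> real" where
  "phi z = real_of_ereal (limsup (\<lambda>n. ereal (ln (Qprod (map z [0..<n]) / Qprod (map z [1..<n])))))"

definition pi_fin :: "(nat \<times> nat) list \<Rightarrow> real \<times> real" where
  "pi_fin w = ((\<Sum>i<length w. real (fst (w ! i)) / 2 ^ (Suc i)),
               (\<Sum>i<length w. real (snd (w ! i)) / 2 ^ (Suc i)))"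

definition pi_inf :: "(nat \<Rightarrow> nat \<times> nat) \<Rightarrow> real \<times> real" where
  "pi_inf \<omega> = ((\<Sum>i. real (fst (\<omega> i)) / 2 ^ (Suc i)),
               (\<Sum>i. real (snd (\<omega> i)) / 2 ^ (Suc i)))"

definition ext_line :: "nat \<Rightarrow> nat \<Rightarrow> (real \<times> real) set" where
  "ext_line p q = {(x, y). \<exists>x' y'. x - x' \<in> \<int> \<and> y - y' \<in> \<int> \<and> (real p / real q) * x' = y'}"

definition Xfin :: "nat \<Rightarrow> nat \<Rightarrow> nat \<Rightarrow> (nat \<times> nat) list set" where
  "Xfin p q n = {w. length w = n \<and> set w \<subseteq> Bset \<and> pi_fin w \<in> ext_line p q}"

definition Xinf :: "nat \<Rightarrow> nat \<Rightarrow> (nat \<Rightarrow> nat \<times> nat) set" where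
  "Xinf p q = {\<omega>. range \<omega> \<subseteq> Bset \<and> pi_inf \<omega> \<in> ext_line p q}"

definition shift :: "(nat \<Rightarrow> 'a) \<Rightarrow> nat \<Rightarrow> nat \<Rightarrow> 'a" where
  "shift \<omega> j = (\<lambda>k. \<omega> (k + j))"

definition cylinder :: "nat \<Rightarrow> nat \<Rightarrow> (nat \<times> nat) list \<Rightarrow> (nat \<Rightarrow> nat \<times> nat) set" where
  "cylinder p q w = {\<omega> \<in> Xinf p q. map \<omega> [0..<length w] = w}"

text \<open>Partition function; exp(sup over an empty cylinder) is read as exp(-infinity) = 0.\<close>
definition Zpart :: "nat \<Rightarrow> nat \<Rightarrow> nat \<Rightarrow> real" where
  "Zpart p q n = (\<Sum>w\<in>Xfin p q n.
      (if cylinder p q w = {} then 0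
       else exp (SUP \<omega>\<in>cylinder p q w. \<Sum>j<n. phi (shift \<omega> j))))"

definition pressure :: "nat \<Rightarrow> nat \<Rightarrow> real" where
  "pressure p q = lim (\<lambda>n. ln (Zpart p q n) / real n)"

end

theory Submission
  imports Defs
begin

text \<open>
  A pair of digit words \<open>(a, b)\<close> determines the point
  \<open>(\<Sum> 2\<^sup>-\<^sup>i dx(a\<^sub>i, b\<^sub>i), \<Sum> 2\<^sup>-\<^sup>i dy(a\<^sub>i, b\<^sub>i))\<close>, and \<open>F\<^sub>a = F\<^sub>b\<close> iff this point lies on the
  line \<open>q y = p x\<close>. The matrix product \<open>Qprod w\<close> counts the pairs whose point is congruent to \<open>\<pi>(w)\<close>
  modulo 1, the four states being the possible carries. Hence the sum of \<open>Qprod\<close> over \<open>X\<^sub>\<theta>\<^sup>n\<close> is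
  the number of pairs with \<open>q Y - p X \<equiv> 0\<close> modulo \<open>2\<^sup>n\<close>, where \<open>(X, Y)\<close> is the point scaled by
  \<open>2\<^sup>n\<close>; it is at least the number \<open>M\<^sub>n\<close> of pairs with \<open>q Y = p X\<close>. As the quotient
  \<open>(q Y - p X) / 2\<^sup>n\<close> is bounded, it can be cancelled by prepending a word of bounded length \<open>L\<close>, so
  the sum is at most \<open>M\<^sub>n\<^sub>+\<^sub>L\<close>. Since \<open>M\<close> is supermultiplicative, \<open>log M\<^sub>n / n\<close>
  converges.

  The Birkhoff sums of \<open>\<phi>\<close> over a cylinder \<open>[w]\<close> equal \<open>log (Qprod w)\<close> up to \<open>log 3\<close>: any product
  of two of the matrices has a positive row and hence contracts ratios of row vectors, so the limsup
  in \<open>\<phi>\<close> is a limit and the sums telescope, and \<open>Qprod\<close> is multiplicative up to a factor 3. Thus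
  the pressure is the limit of \<open>log M\<^sub>n / n\<close>.
\<close>

section \<open>Growth rates of superadditive sequences\<close>

text \<open>Fekete's lemma; the limit is the supremum of the quotients, which the linear bound keeps
  finite.\<close>

lemma superadditive_convergent:
  fixes f :: "nat \<Rightarrow> real"
  assumes super: "\<And>m n. f m + f n \<le> f (m + n)"
    and nonneg: "\<And>n. 0 \<le> f n"
    and bound: "\<And>n. f n \<le> C * real n"
  shows "convergent (\<lambda>n. f n / real n)"
proof -
  define s where "s = (SUP n\<in>{0<..}. f n / real n)"
  have bdd: "bdd_above ((\<lambda>n. f n / real n) ` {0<..})"
    using bound by (intro bdd_aboveI[where M = C]) (auto simp: divide_le_eq)
  have upper: "f n / real n \<le> s" if "n > 0" for n
    unfolding s_def using that bdd by (intro cSUP_upper) auto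
  have mult: "real k * f m \<le> f (k * m + r)" for k m r
  proof (induction k)
    case (Suc k)
    then show ?case
      using super[of m "k * m + r"] by (simp add: algebra_simps)
  qed (simp add: nonneg)
  have "(\<lambda>n. f n / real n) \<longlonglongrightarrow> s"
  proof (rule order_tendstoI)
    fix a assume "a < s"
    then obtain m where m: "m > 0" "a < f m / real m"
      unfolding s_def using bdd by (subst (asm) less_cSUP_iff) auto
    \<comment> \<open>Divide \<open>n\<close> by \<open>m\<close> with remainder; nonnegativity
      drops the remainder at a cost of at most one copy of \<open>f m\<close>.\<close>
    have lower: "f m / real m - f m / real n \<le> f n / real n" if "n > 0" for n
    proof -
      have "real n / real m - 1 \<le> real (n div m)"
        using m(1) dividend_less_times_div[of m n]
        by (simp add: field_simps flip: of_nat_mult of_nat_add)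
      then have "(real n / real m - 1) * f m \<le> real (n div m) * f m"
        by (intro mult_right_mono nonneg)
      also have "\<dots> \<le> f n"
        using mult[of "n div m" m "n mod m"] by simp
      finally have "(real n / real m - 1) * f m / real n \<le> f n / real n"
        by (intro divide_right_mono) auto
      moreover have "(real n / real m - 1) * f m / real n = f m / real m - f m / real n"
        using that m(1) by (simp add: field_simps)
      ultimately show ?thesis by simp
    qed
    have "(\<lambda>n. f m / real m - f m / real n) \<longlonglongrightarrow> f m / real m - 0"
      by (intro tendsto_intros lim_const_over_n)
    then have "\<forall>\<^sub>F n in sequentially. a < f m / real m - f m / real n"
      using m(2) by (intro order_tendstoD(1)) auto
    then show "\<forall>\<^sub>F n in sequentially. a < f n / real n"
      using eventually_gt_at_top[of 0]
    proof eventually_elim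
      case (elim n)
      then show ?case using lower[of n] by linarith
    qed
  next
    fix a assume "s < a"
    show "\<forall>\<^sub>F n in sequentially. f n / real n < a"
      using eventually_gt_at_top[of 0]
    proof eventually_elim
      case (elim n)
      then show ?case using upper[of n] \<open>s < a\<close> by linarith
    qed
  qed
  then show ?thesis by (rule convergentI)
qed

section \<open>Counting lifts of dyadic points\<close>

abbreviation words :: "'a set \<Rightarrow> nat \<Rightarrow> 'a list set" where
  "words A n \<equiv> {w. length w = n \<and> set w \<subseteq> A}"

lemma finite_words: "finite A \<Longrightarrow> finite (words A n)"
  using finite_lists_length_eq[of A n] by (simp add: conj_commute)

lemma card_words: "finite A \<Longrightarrow> card (words A n) = card A ^ n"
  using card_lists_length_eq[of A n] by (simp add: conj_commute)

text \<open>The first letter is the most significant, so this is \<open>2 ^ length w\<close> times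
  the dyadic sum; congruence of points modulo 1 becomes divisibility by
  \<open>2 ^ n\<close>.\<close>

fun word_value :: "('a \<Rightarrow> int) \<Rightarrow> 'a list \<Rightarrow> int" where
  "word_value f [] = 0"
| "word_value f (x # w) = f x * 2 ^ length w + word_value f w"

lemma word_value_append:
  "word_value f (u @ v) = word_value f u * 2 ^ length v + word_value f v"
  by (induction u) (simp_all add: algebra_simps power_add)

lemma word_value_snoc [simp]: "word_value f (w @ [x]) = 2 * word_value f w + f x"
  by (simp add: word_value_append)

lemma word_value_abs_le:
  assumes "\<And>x. x \<in> set w \<Longrightarrow> \<bar>f x\<bar> \<le> K" "K \<ge> 0"
  shows "\<bar>word_value f w\<bar> \<le> K * 2 ^ length w"
  using assms(1)
proof (induction w)
  case (Cons x w)
  have "\<bar>f x * 2 ^ length w\<bar> \<le> K * 2 ^ length w"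
    using Cons.prems[of x] by (simp add: abs_mult)
  moreover have "\<bar>word_value f w\<bar> \<le> K * 2 ^ length w"
    using Cons by simp
  ultimately show ?case by simp
qed (use assms in simp)

text \<open>The symbols 0, 1, 2 stand for the digits \<open>0\<close>, \<open>1\<close>, \<open>p / q\<close>, so that \<open>q\<close> times the difference
  of two digits \<open>a\<close>, \<open>b\<close> is \<open>q * dy (a, b) - p * dx (a, b)\<close>.\<close>
definition syms :: "(nat \<times> nat) set" where
  "syms = {..<3} \<times> {..<3}"

fun dx :: "nat \<times> nat \<Rightarrow> int" where
  "dx (a, b) = of_bool (b = 2) - of_bool (a = 2)"

fun dy :: "nat \<times> nat \<Rightarrow> int" where
  "dy (a, b) = of_bool (a = 1) - of_bool (b = 1)"

lemma finite_syms [simp]: "finite syms"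
  by (simp add: syms_def)

lemma sum_syms:
  "sum f syms = f (0,0) + f (0,1) + f (0,2) + f (1,0) + f (1,1) + f (1,2)
     + f (2,0) + f (2,1) + f (2,2)" for f :: "nat \<times> nat \<Rightarrow> 'a::comm_monoid_add"
proof -
  have "{..<3} = {0, 1, 2 :: nat}" by auto
  then show ?thesis
    unfolding syms_def sum.cartesian_product' by (simp add: add.assoc)
qed

definition lifts :: "nat \<Rightarrow> int \<Rightarrow> int \<Rightarrow> (nat \<times> nat) list set" where
  "lifts n X Y = {c \<in> words syms n.
     2 ^ n dvd word_value dx c - X \<and> 2 ^ n dvd word_value dy c - Y}"

lemma finite_lifts [simp]: "finite (lifts n X Y)"
  unfolding lifts_def by (rule finite_subset[OF _ finite_words[OF finite_syms, of n]]) auto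

text \<open>Splits off the lowest bit: \<open>d\<close> must have the parity of \<open>x\<close>,
  and the halved difference is the target left for the remaining letters.\<close>

lemma pow2_dvd_Suc_iff:
  fixes a x d :: int
  shows "2 ^ Suc n dvd 2 * a + d - x \<longleftrightarrow> even (x - d) \<and> 2 ^ n dvd a - (x - d) div 2"
proof (cases "even (x - d)")
  case True
  then obtain k where k: "x - d = 2 * k" by (rule dvdE)
  then have "2 * a + d - x = 2 * (a - k)" by simp
  then have "2 ^ Suc n dvd 2 * a + d - x \<longleftrightarrow> 2 ^ n dvd a - k"
    unfolding power_Suc by (simp only: dvd_mult_cancel_left) simp
  then show ?thesis using True k by simp
next
  case False
  then have "\<not> 2 dvd 2 * a + d - x" by auto
  then have "\<not> 2 ^ Suc n dvd 2 * a + d - x"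
    by (metis dvd_mult_left power_Suc)
  then show ?thesis using False by blast
qed

lemma card_lifts_Suc:
  "card (lifts (Suc n) X Y) = (\<Sum>d\<in>syms.
     if even (X - dx d) \<and> even (Y - dy d)
     then card (lifts n ((X - dx d) div 2) ((Y - dy d) div 2)) else 0)"
proof -
  define T where "T d = (if even (X - dx d) \<and> even (Y - dy d)
     then (\<lambda>c. c @ [d]) ` lifts n ((X - dx d) div 2) ((Y - dy d) div 2) else {})" for d
  have "lifts (Suc n) X Y = (\<Union>d\<in>syms. T d)"
  proof (intro equalityI subsetI)
    fix w assume w: "w \<in> lifts (Suc n) X Y"
    then obtain c d where "w = c @ [d]"
      by (cases w rule: rev_cases) (auto simp: lifts_def)
    with w show "w \<in> (\<Union>d\<in>syms. T d)"
      unfolding lifts_def T_def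
      by (auto simp: pow2_dvd_Suc_iff simp del: power_Suc)
  next
    fix w assume "w \<in> (\<Union>d\<in>syms. T d)"
    then show "w \<in> lifts (Suc n) X Y"
      unfolding lifts_def T_def
      by (auto simp: pow2_dvd_Suc_iff simp del: power_Suc split: if_splits)
  qed
  also have "card \<dots> = (\<Sum>d\<in>syms. card (T d))"
    by (intro card_UN_disjoint) (auto simp: T_def)
  also have "\<dots> = (\<Sum>d\<in>syms.
     if even (X - dx d) \<and> even (Y - dy d)
     then card (lifts n ((X - dx d) div 2) ((Y - dy d) div 2)) else 0)"
    by (intro sum.cong) (auto simp: T_def card_image inj_on_def)
  finally show ?thesis .
qed

text \<open>The parities select the last letter: three letters have both differences zero, and each
  other class has two letters with opposite differences. A negative difference leaves a carry, hence
  the shifts by 1. So each matrix column holds either a single 3 or two ones.\<close>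

lemma card_lifts_rec:
  "card (lifts (Suc n) (2 * X) (2 * Y)) = 3 * card (lifts n X Y)"
  "card (lifts (Suc n) (2 * X + 1) (2 * Y)) = card (lifts n X Y) + card (lifts n (X + 1) Y)"
  "card (lifts (Suc n) (2 * X) (2 * Y + 1)) = card (lifts n X Y) + card (lifts n X (Y + 1))"
  "card (lifts (Suc n) (2 * X + 1) (2 * Y + 1)) =
     card (lifts n X Y) + card (lifts n (X + 1) (Y + 1))"
  by (simp_all add: card_lifts_Suc sum_syms add.commute[of 1])

section \<open>Row vectors of the matrix products as carry counts\<close>

definition rowvec :: "(nat \<times> nat) list \<Rightarrow> nat \<Rightarrow> real" where
  "rowvec w = foldl (\<lambda>v b. vecmat v (Amat b)) (\<lambda>_. 1) w"

lemma Qprod_rowvec: "Qprod w = rowvec w 0"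
  by (simp add: Qprod_def rowvec_def)

lemma rowvec_snoc: "rowvec (w @ [b]) = vecmat (rowvec w) (Amat b)"
  by (simp add: rowvec_def)

lemma sum_lessThan_4: "(\<Sum>i<4. f i) = f 0 + f (Suc 0) + f 2 + f 3" for f :: "nat \<Rightarrow> real"
  by (simp add: lessThan_Suc eval_nat_numeral)

lemma vecmat_Amat:
  "vecmat v (Amat (0,0)) 0 = 3 * v 0"
  "vecmat v (Amat (0,0)) (Suc 0) = v 0 + v 1"
  "vecmat v (Amat (0,0)) 2 = v 0 + v 2"
  "vecmat v (Amat (0,0)) 3 = v 0 + v 3"
  "vecmat v (Amat (Suc 0,0)) 0 = v 0 + v 1"
  "vecmat v (Amat (Suc 0,0)) (Suc 0) = 3 * v 1"
  "vecmat v (Amat (Suc 0,0)) 2 = v 0 + v 3"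
  "vecmat v (Amat (Suc 0,0)) 3 = v 1 + v 3"
  "vecmat v (Amat (0,Suc 0)) 0 = v 0 + v 2"
  "vecmat v (Amat (0,Suc 0)) (Suc 0) = v 0 + v 3"
  "vecmat v (Amat (0,Suc 0)) 2 = 3 * v 2"
  "vecmat v (Amat (0,Suc 0)) 3 = v 2 + v 3"
  "vecmat v (Amat (Suc 0,Suc 0)) 0 = v 0 + v 3"
  "vecmat v (Amat (Suc 0,Suc 0)) (Suc 0) = v 1 + v 3"
  "vecmat v (Amat (Suc 0,Suc 0)) 2 = v 2 + v 3"
  "vecmat v (Amat (Suc 0,Suc 0)) 3 = 3 * v 3"
  by (simp_all add: vecmat_def sum_lessThan_4 Amat_def numeral_2_eq_2 numeral_3_eq_3)

lemma all_less_4: "(\<forall>j<4. P j) \<longleftrightarrow> P 0 \<and> P (Suc 0) \<and> P 2 \<and> P (3::nat)"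
  by (auto simp: less_Suc_eq eval_nat_numeral)

lemma Bset_cases:
  assumes "b \<in> Bset"
  obtains "b = (0,0)" | "b = (Suc 0,0)" | "b = (0,Suc 0)" | "b = (Suc 0,Suc 0)"
  using assms by (auto simp: Bset_def)

lemma finite_Bset [simp]: "finite Bset"
  by (simp add: Bset_def)

abbreviation xval :: "(nat \<times> nat) list \<Rightarrow> int" where
  "xval \<equiv> word_value (\<lambda>b. int (fst b))"

abbreviation yval :: "(nat \<times> nat) list \<Rightarrow> int" where
  "yval \<equiv> word_value (\<lambda>b. int (snd b))"

text \<open>The state \<open>j\<close> encodes the carry \<open>(j mod 2, j div 2)\<close> passed on by the digits to the right.\<close>
lemma rowvec_eq_card:
  assumes "set w \<subseteq> Bset"
  shows "\<forall>j<4. rowvec w j =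
    real (card (lifts (length w) (xval w + int (j mod 2)) (yval w + int (j div 2))))"
  using assms
proof (induction w rule: rev_induct)
  case Nil
  have "lifts 0 X Y = {[]}" for X Y by (auto simp: lifts_def)
  then show ?case by (simp add: rowvec_def)
next
  case (snoc b w)
  define X Y n where "X = xval w" and "Y = yval w" and "n = length w"
  have b: "b \<in> Bset" using snoc.prems by simp
  have IH: "rowvec w 0 = real (card (lifts n X Y))"
    "rowvec w (Suc 0) = real (card (lifts n (X + 1) Y))"
    "rowvec w 2 = real (card (lifts n X (Y + 1)))"
    "rowvec w 3 = real (card (lifts n (X + 1) (Y + 1)))"
    using snoc by (simp_all add: all_less_4 X_def Y_def n_def)
  \<comment> \<open>A digit and a carry can add up to 2; the overflow is passed on as a carry to the
    next higher position.\<close>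
  have rec2:
    "lifts k (2 * X + 2) Z = lifts k (2 * (X + 1)) Z"
    "lifts k Z (2 * Y + 2) = lifts k Z (2 * (Y + 1))" for k Z by simp_all
  have fin: "card (lifts (length (w @ [b])) (xval (w @ [b]) + int (j mod 2)) (yval (w @ [b]) + int (j div 2)))
      = card (lifts (Suc n) (2 * X + int (fst b + j mod 2)) (2 * Y + int (snd b + j div 2)))" for j
    by (simp add: X_def Y_def n_def ac_simps)
  show ?case
    unfolding fin rowvec_snoc all_less_4
    using b by (cases rule: Bset_cases)
      (simp_all add: vecmat_Amat IH rec2 card_lifts_rec[of n X Y] 
       card_lifts_rec[of n "X + 1" Y]  card_lifts_rec[of n X "Y + 1"]
       card_lifts_rec[of n "X + 1" "Y + 1"] del: distrib_left_numeral)
qed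

section \<open>The potential as a limit\<close>

abbreviation push :: "(nat \<Rightarrow> real) \<Rightarrow> (nat \<times> nat) list \<Rightarrow> nat \<Rightarrow> real" where
  "push v w \<equiv> foldl (\<lambda>v b. vecmat v (Amat b)) v w"

lemma rowvec_append: "rowvec (u @ w) = push (rowvec u) w"
  by (simp add: rowvec_def)

lemma vecmat_mono:
  assumes "\<forall>i<4. v i \<le> C * v' i" "b \<in> Bset"
  shows "\<forall>j<4. vecmat v (Amat b) j \<le> C * vecmat v' (Amat b) j"
  using assms(2) assms(1) unfolding all_less_4
  by (cases rule: Bset_cases) (simp_all add: vecmat_Amat algebra_simps)

lemma push_mono:
  assumes "\<forall>i<4. v i \<le> C * v' i" "set w \<subseteq> Bset"
  shows "\<forall>j<4. push v w j \<le> C * push v' w j"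
  using assms
proof (induction w arbitrary: v v')
  case (Cons b w)
  then show ?case using vecmat_mono[of v C v' b] by simp
qed simp

text \<open>The entries indexed by 1 and 2 correspond to lattice shifts that do not differ by a digit, which
  is why their ratio obeys a weaker bound.\<close>
definition balanced :: "(nat \<Rightarrow> real) \<Rightarrow> bool" where
  "balanced v \<longleftrightarrow> (\<forall>j<4. v j > 0) \<and>
     (\<forall>i<4. \<forall>j<4. v i \<le> (if {i, j} = {1, 2} then 9 / 2 else 3) * v j)"

lemma balanced_alt:
  "balanced v \<longleftrightarrow> (0 < v 0 \<and> 0 < v (Suc 0) \<and> 0 < v 2 \<and> 0 < v 3) \<and>
     v 0 \<le> 3 * v (Suc 0) \<and> v 0 \<le> 3 * v 2 \<and> v 0 \<le> 3 * v 3 \<and>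
     v (Suc 0) \<le> 3 * v 0 \<and> v (Suc 0) \<le> 9 / 2 * v 2 \<and> v (Suc 0) \<le> 3 * v 3 \<and>
     v 2 \<le> 3 * v 0 \<and> v 2 \<le> 9 / 2 * v (Suc 0) \<and> v 2 \<le> 3 * v 3 \<and>
     v 3 \<le> 3 * v 0 \<and> v 3 \<le> 3 * v (Suc 0) \<and> v 3 \<le> 3 * v 2"
  unfolding balanced_def all_less_4 by (auto simp: doubleton_eq_iff)

text \<open>The constant 9/2 comes from \<open>(1,0)\<close>, where entries 1 and 2 become
  \<open>3 * v 1\<close> and \<open>v 0 + v 3\<close>: each of \<open>v 0\<close>,
  \<open>v 3\<close> is at least a third of \<open>v 1\<close>, so the quotient is at most 3 /
  (2/3). The letter \<open>(0,1)\<close> is its mirror image.\<close>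

lemma balanced_vecmat:
  assumes "balanced v" "b \<in> Bset"
  shows "balanced (vecmat v (Amat b))"
  using assms(2) assms(1) unfolding balanced_alt
  by (cases rule: Bset_cases) (simp_all add: vecmat_Amat)

lemma balanced_rowvec: "set w \<subseteq> Bset \<Longrightarrow> balanced (rowvec w)"
proof (induction w rule: rev_induct)
  case Nil
  show ?case by (simp add: rowvec_def balanced_alt)
next
  case (snoc b w)
  then show ?case by (simp add: rowvec_snoc balanced_vecmat)
qed

lemma balanced_pos: "balanced v \<Longrightarrow> j < 4 \<Longrightarrow> 0 < v j"
  by (simp add: balanced_def)

lemma balanced_le:
  assumes "balanced v" "i < 4" "j < 4"
  shows "v i \<le> 9 / 2 * v j"
proof -
  have "v i \<le> (if {i, j} = {1, 2} then 9 / 2 else 3) * v j"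
    using assms by (simp add: balanced_def)
  then show ?thesis
    using balanced_pos[OF assms(1,3)] by (simp split: if_splits)
qed

lemma Qprod_pos: "set w \<subseteq> Bset \<Longrightarrow> 0 < Qprod w"
  using balanced_pos[OF balanced_rowvec, of w 0] by (simp add: Qprod_rowvec)

text \<open>By balance every entry of \<open>rowvec u\<close> is within a factor 3 of entry 0; the
  exceptional pair with 9/2 does not involve entry 0. So \<open>rowvec u\<close> is comparable to a
  multiple of the all-ones vector from which \<open>Qprod w\<close> starts, and \<open>w\<close>
  preserves the comparison.\<close>

lemma Qprod_append_bounds:
  assumes "set u \<subseteq> Bset" "set w \<subseteq> Bset"
  shows "Qprod u * Qprod w \<le> 3 * Qprod (u @ w)" "Qprod (u @ w) \<le> 3 * (Qprod u * Qprod w)"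
proof -
  note bal = balanced_rowvec[OF assms(1), unfolded balanced_alt]
  have "\<forall>j<4. push (\<lambda>_. 1) w j \<le> 3 / rowvec u 0 * push (rowvec u) w j"
    using bal by (intro push_mono assms(2)) (simp add: all_less_4 field_simps)
  then show "Qprod u * Qprod w \<le> 3 * Qprod (u @ w)"
    using bal by (simp add: Qprod_rowvec rowvec_append) (simp add: rowvec_def field_simps)
  have "\<forall>j<4. push (rowvec u) w j \<le> 3 * rowvec u 0 * push (\<lambda>_. 1) w j"
    using bal by (intro push_mono assms(2)) (simp add: all_less_4 field_simps)
  then show "Qprod (u @ w) \<le> 3 * (Qprod u * Qprod w)"
    by (simp add: Qprod_rowvec rowvec_append) (simp add: rowvec_def field_simps)
qed

text \<open>All column sums of the matrices are at least 1, so the first letter takes the all-ones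
  vector to one that dominates it.\<close>

lemma Qprod_Cons_ge:
  assumes "b \<in> Bset" "set w \<subseteq> Bset"
  shows "Qprod w \<le> Qprod (b # w)"
proof -
  have "\<forall>j<4. push (\<lambda>_. 1) w j \<le> 1 * push (vecmat (\<lambda>_. 1) (Amat b)) w j"
    using assms(1) by (intro push_mono assms(2), cases rule: Bset_cases)
      (simp_all add: all_less_4 vecmat_Amat)
  then show ?thesis by (simp add: Qprod_rowvec rowvec_def)
qed

section \<open>Contraction of ratios and convergence\<close>

lemma two_step_positive_row:
  assumes "b \<in> Bset" "c \<in> Bset"
  shows "\<exists>i<4. \<forall>v. (\<forall>k<4. 0 \<le> v k) \<longrightarrow> (\<forall>j<4. v i \<le> vecmat (vecmat v (Amat b)) (Amat c) j)"
proof -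
  \<comment> \<open>The matrices of \<open>(0,0)\<close> and \<open>(1,1)\<close> have a positive
    row themselves; those of \<open>(1,0)\<close> and \<open>(0,1)\<close> have none. Row 1 of
    \<open>(1,0)\<close> vanishes only in column 2, and the second matrix fills this gap unless
    \<open>c = (0,1)\<close>, when row 0 serves instead. The letter \<open>(0,1)\<close> is
    symmetric.\<close>
  define i where "i = (if b = (0,0) then 0 else if b = (1,1) then 3
    else if b = (1,0) then (if c = (0,1) then 0 else 1) else if c = (1,0) then 0 else 2 :: nat)"
  have "\<forall>j<4. v i \<le> vecmat (vecmat v (Amat b)) (Amat c) j" if "\<forall>k<4. 0 \<le> v k" for v
    using assms(1)
  proof (cases rule: Bset_cases)
    case 1
    show ?thesis using assms(2) 1 that
      by (cases rule: Bset_cases) (simp_all add: all_less_4 i_def vecmat_Amat)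
  next
    case 2
    show ?thesis using assms(2) 2 that
      by (cases rule: Bset_cases) (simp_all add: all_less_4 i_def vecmat_Amat)
  next
    case 3
    show ?thesis using assms(2) 3 that
      by (cases rule: Bset_cases) (simp_all add: all_less_4 i_def vecmat_Amat)
  next
    case 4
    show ?thesis using assms(2) 4 that
      by (cases rule: Bset_cases) (simp_all add: all_less_4 i_def vecmat_Amat)
  qed
  moreover have "i < 4" by (simp add: i_def)
  ultimately show ?thesis by blast
qed

lemma vecmat_linear:
  "vecmat (\<lambda>i. v i - c * w i) M j = vecmat v M j - c * vecmat w M j"
  by (simp add: vecmat_def algebra_simps sum_subtractf sum_distrib_left)

text \<open>For positive \<open>t\<close> this encloses all ratios \<open>u j / t j\<close>;
  \<open>M - m\<close> acts as a projective distance of the two vectors.\<close>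

definition pinched :: "(nat \<Rightarrow> real) \<Rightarrow> (nat \<Rightarrow> real) \<Rightarrow> real \<Rightarrow> real \<Rightarrow> bool" where
  "pinched u t m M \<longleftrightarrow> (\<forall>j<4. m * t j \<le> u j \<and> u j \<le> M * t j)"

lemma pinched_vecmat:
  assumes "pinched u t m M" "b \<in> Bset"
  shows "pinched (vecmat u (Amat b)) (vecmat t (Amat b)) m M"
proof -
  have "\<forall>j<4. vecmat (\<lambda>i. m * t i) (Amat b) j \<le> 1 * vecmat u (Amat b) j"
    using assms by (intro vecmat_mono) (auto simp: pinched_def)
  moreover have "vecmat (\<lambda>i. m * t i) (Amat b) j = m * vecmat t (Amat b) j" for j
    by (simp add: vecmat_def sum_distrib_left ac_simps)
  moreover have "\<forall>j<4. vecmat u (Amat b) j \<le> M * vecmat t (Amat b) j"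
    using assms by (intro vecmat_mono) (auto simp: pinched_def)
  ultimately show ?thesis by (simp add: pinched_def)
qed

lemma vecmat_le:
  assumes "\<forall>k<4. v k \<le> a" "\<forall>k<4. 0 \<le> v k" "b \<in> Bset" "j < 4"
  shows "vecmat v (Amat b) j \<le> 3 * a"
proof -
  have "\<forall>j<4. vecmat v (Amat b) j \<le> 3 * a"
    using assms(3) assms(1,2) unfolding all_less_4
    by (cases rule: Bset_cases) (simp_all add: vecmat_Amat)
  then show ?thesis using assms(4) by blast
qed

text \<open>The positive row moves both ends of the enclosing interval towards the ratio at
  its index; the constant 81/2 bounds the growth of a balanced vector in two steps.\<close>
lemma pinched_contract:
  assumes pin: "pinched u t m M" and bal: "balanced t" and b: "b \<in> Bset" and c: "c \<in> Bset"
  shows "\<exists>m' M'. pinched (vecmat (vecmat u (Amat b)) (Amat c)) (vecmat (vecmat t (Amat b)) (Amat c)) m' M'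
     \<and> M' - m' = 79 / 81 * (M - m)"
proof -
  define W where "W v = vecmat (vecmat v (Amat b)) (Amat c)" for v
  obtain i where i: "i < 4" and
    row: "\<And>v j. (\<forall>k<4. 0 \<le> v k) \<Longrightarrow> j < 4 \<Longrightarrow> v i \<le> W v j"
    using two_step_positive_row[OF b c] unfolding W_def by blast
  have W_lin: "W (\<lambda>i. v i - a * w i) j = W v j - a * W w j" for v w a j
    unfolding W_def vecmat_linear[abs_def] by (rule refl)
  have ti: "t i > 0" using bal i by (rule balanced_pos)
  have growth: "W t j \<le> 81 / 2 * t i" if "j < 4" for j
  proof -
    have "vecmat t (Amat b) k \<le> 3 * (9 / 2 * t i)" if "k < 4" for k
      using balanced_le[OF bal _ i] balanced_pos[OF bal] b that
      by (intro vecmat_le) (simp_all add: less_imp_le)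
    then have "\<forall>k<4. vecmat t (Amat b) k \<le> 3 * (9 / 2 * t i)" by blast
    moreover have "\<forall>k<4. 0 \<le> vecmat t (Amat b) k"
      using balanced_pos[OF balanced_vecmat[OF bal b]] by (simp add: less_imp_le)
    ultimately have "W t j \<le> 3 * (3 * (9 / 2 * t i))"
      unfolding W_def using c that by (intro vecmat_le)
    then show ?thesis by simp
  qed
  \<comment> \<open>Distances of the ratio at \<open>i\<close> from the two ends. They add up to the
    length, so moving each end by 2/81 of its distance leaves 79/81 of the length.\<close>
  define \<alpha> \<beta> where "\<alpha> = (u i - m * t i) / t i" and "\<beta> = (M * t i - u i) / t i"
  have nn: "\<alpha> \<ge> 0" "\<beta> \<ge> 0"
    using pin i ti by (auto simp: \<alpha>_def \<beta>_def pinched_def)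
  have sum: "\<alpha> + \<beta> = M - m" using ti by (simp add: \<alpha>_def \<beta>_def field_simps)
  have "(m + 2 / 81 * \<alpha>) * W t j \<le> W u j \<and> W u j \<le> (M - 2 / 81 * \<beta>) * W t j" if j: "j < 4" for j
  proof -
    have "u i - m * t i \<le> W (\<lambda>k. u k - m * t k) j"
      using pin by (intro row[OF _ j, of "\<lambda>k. u k - m * t k"]) (auto simp: pinched_def)
    then have "\<alpha> * t i \<le> W u j - m * W t j"
      using ti unfolding W_lin by (simp add: \<alpha>_def)
    moreover have "2 / 81 * \<alpha> * W t j \<le> 2 / 81 * \<alpha> * (81 / 2 * t i)"
      using nn growth[OF j] by (intro mult_left_mono) auto
    moreover have "M * t i - u i \<le> W (\<lambda>k. M * t k - 1 * u k) j"
      using pin row[OF _ j, of "\<lambda>k. M * t k - 1 * u k"] by (auto simp: pinched_def)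
    then have "M * t i - u i \<le> W (\<lambda>k. M * t k) j - W u j"
      unfolding W_lin by simp
    moreover have "W (\<lambda>k. M * t k) j = M * W t j"
      using W_lin[of "\<lambda>_. 0" "-M" t j] by (simp add: W_def vecmat_def)
    moreover have "\<beta> * t i = M * t i - u i" using ti by (simp add: \<beta>_def)
    moreover have "2 / 81 * \<beta> * W t j \<le> 2 / 81 * \<beta> * (81 / 2 * t i)"
      using nn growth[OF j] by (intro mult_left_mono) auto
    ultimately show ?thesis by (simp add: algebra_simps)
  qed
  then have "pinched (W u) (W t) (m + 2 / 81 * \<alpha>) (M - 2 / 81 * \<beta>)"
    by (simp add: pinched_def)
  moreover have "(M - 2 / 81 * \<beta>) - (m + 2 / 81 * \<alpha>) = 79 / 81 * (M - m)"
    unfolding sum[symmetric] using sum by (simp add: algebra_simps)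
  ultimately show ?thesis unfolding W_def by blast
qed

text \<open>After the first letter both vectors are multiplied by the same matrices, so the
  enclosing intervals are nested and shrink geometrically, once every two letters.\<close>

lemma Qprod_ratio_convergent:
  assumes "range z \<subseteq> Bset"
  shows "convergent (\<lambda>n. Qprod (map z [0..<n]) / Qprod (map z [1..<n]))"
proof -
  define u t where "u n = rowvec (map z [0..<n])" and "t n = rowvec (map z [1..<n])" for n
  have z: "z n \<in> Bset" for n using assms by auto
  have bal: "balanced (t n)" for n
    unfolding t_def using z by (intro balanced_rowvec) auto
  have u_Suc: "u (Suc n) = vecmat (u n) (Amat (z n))" for n
    by (simp add: u_def rowvec_snoc)
  \<comment> \<open>For \<open>n = 0\<close> this fails: \<open>t 1\<close> comes from the empty
    word and does not see \<open>z 0\<close>.\<close>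
  have t_Suc: "t (Suc n) = vecmat (t n) (Amat (z n))" if "n \<ge> 1" for n
    using that by (simp add: t_def rowvec_snoc)
  have step: "pinched (u n) (t n) m M" if "pinched (u k) (t k) m M" "k \<ge> 1" "n \<ge> k" for n k m M
    using that(3,1,2) by (induction rule: dec_induct) (simp_all add: u_Suc t_Suc pinched_vecmat z)
  \<comment> \<open>\<open>t 1\<close> is the all-ones vector, and \<open>u 1\<close> consists of
    the column sums of one matrix, each 2 or 3.\<close>
  have "\<forall>j<4. 1 * t 1 j \<le> u 1 j \<and> u 1 j \<le> 3 * t 1 j"
    using z[of 0] by (cases rule: Bset_cases)
      (simp_all add: u_def t_def rowvec_def all_less_4 vecmat_Amat)
  then have base: "pinched (u 1) (t 1) 1 3" by (simp add: pinched_def)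
  have iter: "\<exists>m M. pinched (u (2 * k + 1)) (t (2 * k + 1)) m M \<and> M - m = (79 / 81) ^ k * 2" for k
  proof (induction k)
    case 0
    show ?case using base by (intro exI[of _ 1] exI[of _ 3]) simp
  next
    case (Suc k)
    then obtain m M where mM: "pinched (u (2 * k + 1)) (t (2 * k + 1)) m M"
      "M - m = (79 / 81) ^ k * 2" by blast
    from pinched_contract[OF mM(1) bal z z, of "2 * k + 1" "2 * k + 2"] mM(2)
    show ?case by (simp add: u_Suc t_Suc)
  qed
  have "Cauchy (\<lambda>n. u n 0 / t n 0)"
    unfolding Cauchy_altdef2
  proof (intro allI impI)
    fix e :: real assume "e > 0"
    then have "\<exists>k. (79 / 81 :: real) ^ k < e / 2"
      by (intro real_arch_pow_inv) auto
    then obtain k where k: "(79 / 81 :: real) ^ k * 2 < e" by (auto simp: field_simps)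
    obtain m M where mM: "pinched (u (2 * k + 1)) (t (2 * k + 1)) m M"
      "M - m = (79 / 81) ^ k * 2" using iter by blast
    have enc: "m \<le> u n 0 / t n 0 \<and> u n 0 / t n 0 \<le> M" if "n \<ge> 2 * k + 1" for n
      using step[OF mM(1) _ that] balanced_pos[OF bal, of 0 n]
      by (simp add: pinched_def pos_le_divide_eq pos_divide_le_eq)
    have "dist (u n 0 / t n 0) (u (2 * k + 1) 0 / t (2 * k + 1) 0) < e" if "n \<ge> 2 * k + 1" for n
      using enc[OF that] enc[OF order_refl] mM(2) k by (simp only: dist_real_def) linarith
    then show "\<exists>N. \<forall>n\<ge>N. dist (u n 0 / t n 0) (u N 0 / t N 0) < e" by blast
  qed
  then show ?thesis
    by (simp add: Qprod_rowvec u_def t_def Cauchy_convergent_iff)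
qed

lemma phi_limit:
  assumes "range z \<subseteq> Bset"
  shows "(\<lambda>n. ln (Qprod (map z [0..<n])) - ln (Qprod (map z [1..<n]))) \<longlonglongrightarrow> phi z"
proof -
  have z: "z n \<in> Bset" for n using assms by auto
  have pos: "Qprod (map z [k..<n]) > 0" for k n
    using z by (intro Qprod_pos) auto
  obtain L where L: "(\<lambda>n. Qprod (map z [0..<n]) / Qprod (map z [1..<n])) \<longlonglongrightarrow> L"
    using Qprod_ratio_convergent[OF assms] by (auto simp: convergent_def)
  \<comment> \<open>This keeps the limit of the ratios away from 0, so that \<open>ln\<close> is
    continuous there.\<close>
  have "1 \<le> Qprod (map z [0..<n]) / Qprod (map z [1..<n])" if "n \<ge> 1" for n
  proof -
    have "map z [0..<n] = z 0 # map z [1..<n]"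
      using that by (simp add: upt_conv_Cons)
    moreover have "set (map z [1..<n]) \<subseteq> Bset" using z by auto
    ultimately show ?thesis
      using Qprod_Cons_ge[OF z[of 0], of "map z [1..<n]"] pos[of 1 n]
      by (simp add: pos_le_divide_eq)
  qed
  then have "1 \<le> L"
    by (intro LIMSEQ_le_const[OF L]) blast
  then have lim: "(\<lambda>n. ln (Qprod (map z [0..<n]) / Qprod (map z [1..<n]))) \<longlonglongrightarrow> ln L"
    by (intro tendsto_ln L) auto
  then have "limsup (\<lambda>n. ereal (ln (Qprod (map z [0..<n]) / Qprod (map z [1..<n])))) = ereal (ln L)"
    by (intro lim_imp_Limsup) auto
  then have "phi z = ln L" by (simp add: phi_def)
  moreover have "ln (Qprod (map z [0..<n]) / Qprod (map z [1..<n]))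
      = ln (Qprod (map z [0..<n])) - ln (Qprod (map z [1..<n]))" for n
    using pos by (intro ln_divide_pos)
  ultimately show ?thesis using lim by simp
qed

section \<open>Birkhoff sums of the potential\<close>

lemma map_shift: "map (shift \<omega> j) [k..<n] = map \<omega> [k + j..<n + j]"
  by (rule nth_equalityI) (auto simp: shift_def ac_simps)

lemma phi_sum_bounds:
  assumes \<omega>: "range \<omega> \<subseteq> Bset"
  shows "\<bar>(\<Sum>j<n. phi (shift \<omega> j)) - ln (Qprod (map \<omega> [0..<n]))\<bar> \<le> ln 3"
proof -
  have set: "set (map \<omega> [k..<m]) \<subseteq> Bset" for k m using \<omega> by auto
  note pos = Qprod_pos[OF set]
  define l where "l j N = ln (Qprod (map \<omega> [j..<N]))" for j N
  have "(\<lambda>N. l j N - l (Suc j) N) \<longlonglongrightarrow> phi (shift \<omega> j)" for j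
  proof -
    have "range (shift \<omega> j) \<subseteq> Bset" using \<omega> by (auto simp: shift_def)
    \<comment> \<open>Offsetting the index by \<open>j\<close> gives all these limits the same right
      end \<open>N\<close>, so that their sum telescopes.\<close>
    from phi_limit[OF this] show ?thesis
      unfolding l_def by - (rule LIMSEQ_offset[where k = j], simp add: map_shift)
  qed
  then have "(\<lambda>N. \<Sum>j<n. l j N - l (Suc j) N) \<longlonglongrightarrow> (\<Sum>j<n. phi (shift \<omega> j))"
    by (intro tendsto_sum)
  moreover have "(\<Sum>j<n. l j N - l (Suc j) N) = l 0 N - l n N" for N
    by (rule sum_lessThan_telescope'[of "\<lambda>j. l j N"])
  ultimately have "(\<lambda>N. l 0 N - l n N) \<longlonglongrightarrow> (\<Sum>j<n. phi (shift \<omega> j))"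
    by simp
  then have lim: "(\<lambda>N. \<bar>(l 0 N - l n N) - l 0 n\<bar>) \<longlonglongrightarrow> \<bar>(\<Sum>j<n. phi (shift \<omega> j)) - l 0 n\<bar>"
    by (intro tendsto_intros)
  \<comment> \<open>Quasi-multiplicativity for the word cut at position \<open>n\<close>, uniformly
    in \<open>N\<close>.\<close>
  have "\<bar>(l 0 N - l n N) - l 0 n\<bar> \<le> ln 3" if "N \<ge> n" for N
  proof -
    define u w where "u = map \<omega> [0..<n]" and "w = map \<omega> [n..<N]"
    have "[0..<N] = [0..<n] @ [n..<N]"
      using that by (metis le_add_diff_inverse upt_add_eq_append zero_le)
    then have uw: "map \<omega> [0..<N] = u @ w" by (simp add: u_def w_def)
    have B: "set u \<subseteq> Bset" "set w \<subseteq> Bset" using set by (auto simp: u_def w_def)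
    have p: "Qprod u > 0" "Qprod w > 0" "Qprod (u @ w) > 0"
      using B by (simp_all add: Qprod_pos)
    have "ln (Qprod u * Qprod w) \<le> ln (3 * Qprod (u @ w))"
      "ln (Qprod (u @ w)) \<le> ln (3 * (Qprod u * Qprod w))"
      using Qprod_append_bounds[OF B] p by (auto intro!: ln_mono)
    then show ?thesis
      unfolding l_def uw using p
      by (simp add: ln_mult_pos flip: u_def w_def)
  qed
  then have "\<bar>(\<Sum>j<n. phi (shift \<omega> j)) - l 0 n\<bar> \<le> ln 3"
    by (intro LIMSEQ_le_const2[OF lim]) blast
  then show ?thesis unfolding l_def .
qed

section \<open>Words on the extended line\<close>

lemma word_value_lincomb:
  "word_value (\<lambda>x. a * f x - b * g x) w = a * word_value f w - b * word_value g w"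
  by (induction w) (simp_all add: algebra_simps)

lemma word_value_map: "word_value f (map g w) = word_value (\<lambda>x. f (g x)) w"
  by (induction w) simp_all

text \<open>Read binary digits from the lowest one up. Together with uniqueness below, the words of
  length \<open>n\<close> over \<open>Bset\<close> are a complete residue system for integer pairs
  modulo \<open>2 ^ n\<close>.\<close>

lemma residue_word_exists:
  "\<exists>w\<in>words Bset n. 2 ^ n dvd X - xval w \<and> 2 ^ n dvd Y - yval w"
proof (induction n arbitrary: X Y)
  case 0
  show ?case by simp
next
  case (Suc n)
  obtain w where w: "w \<in> words Bset n" "2 ^ n dvd X div 2 - xval w" "2 ^ n dvd Y div 2 - yval w"
    using Suc by blast
  define b where "b = (nat (X mod 2), nat (Y mod 2))"
  have "b \<in> Bset"
    by (cases "even X"; cases "even Y") (simp_all add: b_def Bset_def even_iff_mod_2_eq_zero odd_iff_mod_2_eq_one)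
  moreover have "X - xval (w @ [b]) = 2 * (X div 2 - xval w)"
    "Y - yval (w @ [b]) = 2 * (Y div 2 - yval w)"
    by (simp_all add: b_def minus_mod_eq_mult_div)
  ultimately show ?case
    using w by (intro bexI[of _ "w @ [b]"]) (auto simp del: word_value_snoc right_diff_distrib_numeral)
qed

lemma residue_word_unique:
  assumes "u \<in> words Bset n" "w \<in> words Bset n"
    and "2 ^ n dvd xval u - xval w" "2 ^ n dvd yval u - yval w"
  shows "u = w"
  using assms
proof (induction n arbitrary: u w)
  case (Suc n)
  obtain u' b where u: "u = u' @ [b]" using Suc.prems(1) by (cases u rule: rev_cases) auto
  obtain w' c where w: "w = w' @ [c]" using Suc.prems(2) by (cases w rule: rev_cases) auto
  have bc: "b \<in> Bset" "c \<in> Bset" using Suc.prems(1,2) u w by auto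
  have dvds: "2 * 2 ^ n dvd 2 * (xval u' - xval w') + (int (fst b) - int (fst c))"
     "2 * 2 ^ n dvd 2 * (yval u' - yval w') + (int (snd b) - int (snd c))"
    using Suc.prems(3,4) by (simp_all add: u w algebra_simps)
  then have "even (int (fst b) - int (fst c))" "even (int (snd b) - int (snd c))"
    by (meson dvd_add_right_iff dvd_mult_left dvd_triv_left)+
  then have "b = c" using bc by (auto simp: Bset_def)
  with dvds have "2 * 2 ^ n dvd 2 * (xval u' - xval w')" "2 * 2 ^ n dvd 2 * (yval u' - yval w')"
    by (simp_all del: right_diff_distrib_numeral)
  then have "2 ^ n dvd xval u' - xval w'" "2 ^ n dvd yval u' - yval w'"
    by (simp_all only: dvd_mult_cancel_left) simp_all
  then have "u' = w'" using Suc u w by auto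
  with \<open>b = c\<close> show ?case by (simp add: u w)
qed simp

lemma dyadic_sum:
  "(\<Sum>i<length w. real (f (w ! i)) / 2 ^ Suc i)
     = real_of_int (word_value (\<lambda>b. int (f b)) w) / 2 ^ length w"
proof (induction w rule: rev_induct)
  case (snoc b w)
  have "(\<Sum>i<length w. real (f ((w @ [b]) ! i)) / 2 ^ Suc i)
      = (\<Sum>i<length w. real (f (w ! i)) / 2 ^ Suc i)"
    by (intro sum.cong) (auto simp: nth_append)
  with snoc.IH show ?case by (simp add: field_simps)
qed simp

lemma pi_fin_eq: "pi_fin w = (xval w / 2 ^ length w, yval w / 2 ^ length w)"
  unfolding pi_fin_def dyadic_sum by simp

text \<open>Integer translations change \<open>q y - p x\<close> by an integer. Conversely, Bezout
  coefficients give a translation that removes any integer value of this form.\<close>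

lemma ext_line_iff:
  assumes "coprime p q" "q > 0"
  shows "(x, y) \<in> ext_line p q \<longleftrightarrow> real q * y - real p * x \<in> \<int>"
proof
  assume "(x, y) \<in> ext_line p q"
  then obtain x' y' where xy: "x - x' \<in> \<int>" "y - y' \<in> \<int>" "real p / real q * x' = y'"
    by (auto simp: ext_line_def)
  have "real q * y - real p * x = real q * (y - y') - real p * (x - x')"
    using xy(3) assms(2) by (auto simp: field_simps)
  then show "real q * y - real p * x \<in> \<int>" using xy(1,2) by simp
next
  assume "real q * y - real p * x \<in> \<int>"
  then obtain k where k: "real q * y - real p * x = of_int k" by (auto elim: Ints_cases)
  obtain a b where ab: "a * int q + b * int p = 1"
    using assms(1) by (metis bezout_int coprime_commute coprime_imp_gcd_eq_1 coprime_int_iff)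
  define x' y' where "x' = x + real_of_int (k * b)" and "y' = y - real_of_int (k * a)"
  have "real_of_int a * real q + real_of_int b * real p = 1"
    using arg_cong[OF ab, of real_of_int] by simp
  then have "real_of_int k * (real_of_int a * real q + real_of_int b * real p) = real_of_int k" by simp
  then have "real p / real q * x' = y'"
    using k assms(2) by (simp add: x'_def y'_def field_simps)
  moreover have "x - x' \<in> \<int>" "y - y' \<in> \<int>"
    unfolding x'_def y'_def by (simp_all del: of_int_mult)
  ultimately show "(x, y) \<in> ext_line p q"
    unfolding ext_line_def by blast
qed

lemma Xfin_iff:
  assumes "coprime p q" "q > 0"
  shows "w \<in> Xfin p q n \<longleftrightarrow> w \<in> words Bset n \<and> 2 ^ n dvd int q * yval w - int p * xval w"
proof (cases "w \<in> words Bset n")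
  case True
  then have n: "length w = n" by simp
  have "w \<in> Xfin p q n \<longleftrightarrow> real_of_int (int q * yval w - int p * xval w) / real_of_int (2 ^ n) \<in> \<int>"
    using True by (simp add: Xfin_def pi_fin_eq ext_line_iff[OF assms] diff_divide_distrib)
  also have "\<dots> \<longleftrightarrow> 2 ^ n dvd int q * yval w - int p * xval w"
    by (rule of_int_div_of_int_in_Ints_iff[THEN trans]) simp
  finally show ?thesis using True by blast
qed (auto simp: Xfin_def)

lemma finite_Xfin: "finite (Xfin p q n)"
  by (rule finite_subset[OF _ finite_words[OF finite_Bset, of n]]) (auto simp: Xfin_def)

text \<open>Padding with \<open>(0, 0)\<close> does not move the point, so it stays on the extended
  line.\<close>

lemma cylinder_nonempty:
  assumes "w \<in> Xfin p q n"
  shows "cylinder p q w \<noteq> {}"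
proof -
  define \<omega> where "\<omega> i = (if i < length w then w ! i else (0, 0))" for i
  have "(\<Sum>i. real (f (\<omega> i)) / 2 ^ Suc i) = (\<Sum>i<length w. real (f (w ! i)) / 2 ^ Suc i)"
    if "f (0, 0) = 0" for f
    by (subst suminf_finite[of "{..<length w}"]) (auto simp: \<omega>_def that intro!: sum.cong)
  then have "pi_inf \<omega> = pi_fin w"
    by (simp add: pi_inf_def pi_fin_def del: power_Suc)
  moreover have "range \<omega> \<subseteq> Bset"
    using assms by (auto simp: \<omega>_def Xfin_def Bset_def dest!: nth_mem)
  moreover have "map \<omega> [0..<length w] = w"
    by (rule nth_equalityI) (auto simp: \<omega>_def)
  ultimately have "\<omega> \<in> cylinder p q w"
    using assms by (simp add: cylinder_def Xinf_def Xfin_def)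
  then show ?thesis by blast
qed

text \<open>By \<open>phi_sum_bounds\<close> each supremum is within \<open>ln 3\<close> of
  \<open>ln (Qprod w)\<close>; exponentiation turns this into the factor 3.\<close>

lemma Zpart_bounds:
  "(\<Sum>w\<in>Xfin p q n. Qprod w) / 3 \<le> Zpart p q n"
  "Zpart p q n \<le> 3 * (\<Sum>w\<in>Xfin p q n. Qprod w)"
proof -
  have bounds: "Qprod w / 3 \<le> exp (SUP \<omega>\<in>cylinder p q w. \<Sum>j<n. phi (shift \<omega> j)) \<and>
     exp (SUP \<omega>\<in>cylinder p q w. \<Sum>j<n. phi (shift \<omega> j)) \<le> 3 * Qprod w"
    if w: "w \<in> Xfin p q n" for w
  proof -
    let ?S = "\<lambda>\<omega>. \<Sum>j<n. phi (shift \<omega> j)"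
    have "length w = n" "set w \<subseteq> Bset" using w by (auto simp: Xfin_def)
    then have pos: "Qprod w > 0" by (intro Qprod_pos)
    have S: "\<bar>?S \<omega> - ln (Qprod w)\<bar> \<le> ln 3" if "\<omega> \<in> cylinder p q w" for \<omega>
      using phi_sum_bounds[of \<omega> n] that \<open>length w = n\<close> by (auto simp: cylinder_def Xinf_def)
    obtain \<omega> where \<omega>: "\<omega> \<in> cylinder p q w" using cylinder_nonempty[OF w] by blast
    have "bdd_above (?S ` cylinder p q w)"
      using S by (intro bdd_aboveI[of _ "ln (Qprod w) + ln 3"]) (force simp: abs_le_iff)
    then have "?S \<omega> \<le> (SUP \<omega>\<in>cylinder p q w. ?S \<omega>)"
      using \<omega> by (intro cSUP_upper)
    then have "ln (Qprod w) - ln 3 \<le> (SUP \<omega>\<in>cylinder p q w. ?S \<omega>)"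
      using S[OF \<omega>] by linarith
    moreover have "(SUP \<omega>\<in>cylinder p q w. ?S \<omega>) \<le> ln (Qprod w) + ln 3"
      using \<omega> S by (intro cSUP_least) (force simp: abs_le_iff)+
    ultimately have "exp (ln (Qprod w) - ln 3) \<le> exp (SUP \<omega>\<in>cylinder p q w. ?S \<omega>)"
      "exp (SUP \<omega>\<in>cylinder p q w. ?S \<omega>) \<le> exp (ln (Qprod w) + ln 3)" by simp_all
    then show ?thesis using pos by (simp add: exp_diff exp_add)
  qed
  have Z: "Zpart p q n = (\<Sum>w\<in>Xfin p q n. exp (SUP \<omega>\<in>cylinder p q w. \<Sum>j<n. phi (shift \<omega> j)))"
    unfolding Zpart_def by (intro sum.cong refl) (simp add: cylinder_nonempty)
  show "(\<Sum>w\<in>Xfin p q n. Qprod w) / 3 \<le> Zpart p q n"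
    unfolding Z sum_divide_distrib using bounds by (intro sum_mono) blast
  show "Zpart p q n \<le> 3 * (\<Sum>w\<in>Xfin p q n. Qprod w)"
    unfolding Z sum_distrib_left using bounds by (intro sum_mono) blast
qed

section \<open>The congruence and the equation for pair words\<close>

abbreviation sval :: "nat \<Rightarrow> nat \<Rightarrow> (nat \<times> nat) list \<Rightarrow> int" where
  "sval p q \<equiv> word_value (\<lambda>d. int q * dy d - int p * dx d)"

text \<open>The condition for the point of a pair word to lie on the extended line;
  \<open>sol\<close> is the condition for the line itself.\<close>

definition modsol :: "nat \<Rightarrow> nat \<Rightarrow> nat \<Rightarrow> (nat \<times> nat) list set" where
  "modsol p q n = {c \<in> words syms n. 2 ^ n dvd sval p q c}"

definition sol :: "nat \<Rightarrow> nat \<Rightarrow> nat \<Rightarrow> (nat \<times> nat) list set" where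
  "sol p q n = {c \<in> words syms n. sval p q c = 0}"

lemma finite_modsol: "finite (modsol p q n)"
  by (rule finite_subset[OF _ finite_words[OF finite_syms, of n]]) (auto simp: modsol_def)

lemma finite_sol: "finite (sol p q n)"
  by (rule finite_subset[OF _ finite_words[OF finite_syms, of n]]) (auto simp: sol_def)

text \<open>Sort the pair words by the residue word of their point: the congruence depends only on
  that class, and \<open>Qprod w\<close> counts the lifts of the class of \<open>w\<close>.\<close>

lemma sum_Qprod_eq_card:
  assumes "coprime p q" "q > 0"
  shows "(\<Sum>w\<in>Xfin p q n. Qprod w) = real (card (modsol p q n))"
proof -
  have key: "2 ^ n dvd sval p q c \<longleftrightarrow> w \<in> Xfin p q n"
    if c: "c \<in> lifts n (xval w) (yval w)" and w: "w \<in> words Bset n" for c w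
  proof -
    have "2 ^ n dvd word_value dx c - xval w" "2 ^ n dvd word_value dy c - yval w"
      using c by (simp_all add: lifts_def)
    then have "2 ^ n dvd int q * (word_value dy c - yval w) - int p * (word_value dx c - xval w)"
      by (intro dvd_diff[OF dvd_mult dvd_mult])
    also have "\<dots> = sval p q c - (int q * yval w - int p * xval w)"
      unfolding word_value_lincomb by (simp add: algebra_simps)
    finally show ?thesis
      using w dvd_add_right_iff[of "2 ^ n" "sval p q c - (int q * yval w - int p * xval w)"
        "int q * yval w - int p * xval w"]
      by (simp only: Xfin_iff[OF assms] diff_add_cancel simp_thms)
  qed
  have "modsol p q n = (\<Union>w\<in>Xfin p q n. lifts n (xval w) (yval w))"
  proof (intro equalityI subsetI)
    fix c assume c: "c \<in> modsol p q n"
    obtain w where w: "w \<in> words Bset n" "2 ^ n dvd word_value dx c - xval w"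
      "2 ^ n dvd word_value dy c - yval w"
      using residue_word_exists by blast
    then have "c \<in> lifts n (xval w) (yval w)"
      using c by (simp add: lifts_def modsol_def)
    with key[OF this w(1)] c show "c \<in> (\<Union>w\<in>Xfin p q n. lifts n (xval w) (yval w))"
      by (auto simp: modsol_def)
  next
    fix c assume "c \<in> (\<Union>w\<in>Xfin p q n. lifts n (xval w) (yval w))"
    then obtain w where w: "w \<in> Xfin p q n" "c \<in> lifts n (xval w) (yval w)" by blast
    then show "c \<in> modsol p q n"
      using key[OF w(2)] by (auto simp: modsol_def Xfin_def lifts_def)
  qed
  moreover have "lifts n (xval u) (yval u) \<inter> lifts n (xval w) (yval w) = {}"
    if "u \<in> Xfin p q n" "w \<in> Xfin p q n" "u \<noteq> w" for u w
  proof (rule ccontr)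
    assume "\<not> ?thesis"
    then obtain c where "c \<in> lifts n (xval u) (yval u)" "c \<in> lifts n (xval w) (yval w)" by blast
    then have "2 ^ n dvd (word_value dx c - xval w) - (word_value dx c - xval u)"
      "2 ^ n dvd (word_value dy c - yval w) - (word_value dy c - yval u)"
      unfolding lifts_def by (blast intro: dvd_diff)+
    then have "u = w"
      using that by (intro residue_word_unique[of u n w]) (auto simp: Xfin_def)
    with that show False by simp
  qed
  ultimately have "card (modsol p q n) = (\<Sum>w\<in>Xfin p q n. card (lifts n (xval w) (yval w)))"
    by (simp add: card_UN_disjoint finite_Xfin)
  moreover have "Qprod w = real (card (lifts n (xval w) (yval w)))" if "w \<in> Xfin p q n" for w
    using that rowvec_eq_card[of w] by (auto simp: Qprod_rowvec Xfin_def)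
  ultimately show ?thesis by simp
qed

lemma sval_nat_exists: "\<exists>c. set c \<subseteq> syms \<and> sval p q c = int q * int s - int p * int t"
proof (induction "s + t" arbitrary: s t rule: less_induct)
  case less
  show ?case
  proof (cases "s + t = 0")
    case True
    then show ?thesis by (intro exI[of _ "[]"]) simp
  next
    case False
    then have "s div 2 + t div 2 < s + t" by auto
    then obtain c where c: "set c \<subseteq> syms" "sval p q c = int q * int (s div 2) - int p * int (t div 2)"
      using less by blast
    \<comment> \<open>The first symbol carries the bit of \<open>s\<close> into \<open>dy\<close>,
      and a symbol 2 in second place carries the bit of \<open>t\<close> into
      \<open>dx\<close>.\<close>
    define d where "d = (s mod 2, 2 * (t mod 2))"
    have d: "d \<in> syms" "dy d = int (s mod 2)" "dx d = int (t mod 2)"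
      by (cases "even s"; cases "even t"; simp add: d_def syms_def even_iff_mod_2_eq_zero odd_iff_mod_2_eq_one)+
    have "int s = 2 * int (s div 2) + int (s mod 2)" "int t = 2 * int (t div 2) + int (t mod 2)"
      by (simp_all add: zdiv_int zmod_int)
    then have "sval p q (c @ [d]) = int q * int s - int p * int t"
      by (simp only: word_value_snoc c d) (simp add: algebra_simps)
    then show ?thesis using c d by (intro exI[of _ "c @ [d]"]) auto
  qed
qed

lemma sval_map_swap: "sval p q (map prod.swap c) = - sval p q c"
proof -
  have "dx (prod.swap d) = - dx d" "dy (prod.swap d) = - dy d" for d by (cases d; simp)+
  then show ?thesis
    by (induction c) (simp_all add: algebra_simps)
qed

text \<open>Bezout with natural coefficients gives the value 1 and, by scaling, every nonnegative
  value; swapping the two words changes the sign.\<close>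

lemma sval_exists:
  assumes "coprime p q" "q > 0"
  shows "\<exists>c. set c \<subseteq> syms \<and> sval p q c = k"
proof -
  obtain x y where "q * x = p * y + 1"
    using bezout_nat[of q p] assms by (auto simp: gcd.commute)
  then have "int q * int x - int p * int y = 1"
    by (simp flip: of_nat_mult)
  then have "int q * int (x * m) - int p * int (y * m) = int m" for m
    by (metis (no_types, lifting) left_diff_distrib mult.assoc mult_1 of_nat_mult)
  then have nat: "\<exists>c. set c \<subseteq> syms \<and> sval p q c = int m" for m
    using sval_nat_exists by metis
  show ?thesis
  proof (cases "k \<ge> 0")
    case True
    then show ?thesis using nat[of "nat k"] by simp
  next
    case False
    then obtain c where "set c \<subseteq> syms" "sval p q c = - k" using nat[of "nat (- k)"] by auto
    then show ?thesis
      by (intro exI[of _ "map prod.swap c"]) (auto simp: sval_map_swap syms_def)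
  qed
qed

lemma sval_replicate_zero [simp]: "sval p q (replicate n (0, 0)) = 0"
  by (induction n) simp_all

text \<open>Leading \<open>(0, 0)\<close> letters leave the value unchanged, so finitely many words
  can be padded to one common length.\<close>

lemma sval_exists_uniform:
  assumes "coprime p q" "q > 0" "finite K"
  shows "\<exists>L. \<forall>k\<in>K. \<exists>c\<in>words syms L. sval p q c = k"
proof -
  obtain f where f: "\<And>k. set (f k) \<subseteq> syms" "\<And>k. sval p q (f k) = k"
    using sval_exists[OF assms(1,2)] by metis
  define L where "L = Max (insert 0 (length ` f ` K))"
  have "\<exists>c\<in>words syms L. sval p q c = k" if "k \<in> K" for k
  proof -
    have le: "length (f k) \<le> L" unfolding L_def using that assms(3) by (intro Max_ge) auto
    have "(0, 0) \<in> syms" by (simp add: syms_def)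
    with le f show ?thesis
      by (intro bexI[of _ "replicate (L - length (f k)) (0, 0) @ f k"])
        (auto simp: word_value_append)
  qed
  then show ?thesis by blast
qed

lemma card_sol_le_modsol: "card (sol p q n) \<le> card (modsol p q n)"
  by (rule card_mono[OF finite_modsol]) (auto simp: sol_def modsol_def)

lemma card_modsol_le_sol:
  assumes "coprime p q" "q > 0" "p \<le> q"
  obtains L where "\<And>n. card (modsol p q n) \<le> card (sol p q (n + L))"
proof -
  obtain L where "\<forall>k\<in>{- int q..int q}. \<exists>c\<in>words syms L. sval p q c = k"
    using sval_exists_uniform[OF assms(1,2), of "{- int q..int q}"] by blast
  then have ex: "\<exists>c. c \<in> words syms L \<and> sval p q c = k" if "\<bar>k\<bar> \<le> int q" for k
    using that by (simp add: abs_le_iff Bex_def)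
  define pre where "pre k = (SOME c. c \<in> words syms L \<and> sval p q c = k)" for k
  have pre: "pre k \<in> words syms L \<and> sval p q (pre k) = k" if "\<bar>k\<bar> \<le> int q" for k
    unfolding pre_def using ex[OF that] by (rule someI_ex)
  \<comment> \<open>The value is \<open>q\<close> times the difference of two digits in [0, 1]; here
    \<open>p \<le> q\<close> enters.\<close>
  have digit: "\<bar>int q * dy d - int p * dx d\<bar> \<le> int q" for d
    using assms(3) by (cases d) auto
  \<comment> \<open>If \<open>sval p q c = k * 2 ^ n\<close>, a prefix of value \<open>-k\<close>
    contributes \<open>- k * 2 ^ n\<close> and cancels it. The prefix depends on \<open>c\<close>,
    but its length does not, so \<open>c\<close> can be recovered.\<close>
  have "card (modsol p q n) \<le> card (sol p q (n + L))" for n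
  proof (rule card_inj_on_le[where f = "\<lambda>c. pre (- (sval p q c div 2 ^ n)) @ c", OF _ _ finite_sol])
    have k: "\<bar>- (sval p q c div 2 ^ n)\<bar> \<le> int q" if c: "c \<in> modsol p q n" for c
    proof -
      have "\<bar>sval p q c\<bar> \<le> int q * 2 ^ n"
        using word_value_abs_le[of c _ "int q"] digit c by (auto simp: modsol_def)
      moreover obtain m where m: "sval p q c = 2 ^ n * m"
        using c by (auto simp: modsol_def)
      ultimately show ?thesis by (simp add: abs_mult mult.commute)
    qed
    show "inj_on (\<lambda>c. pre (- (sval p q c div 2 ^ n)) @ c) (modsol p q n)"
    proof (rule inj_onI)
      fix c d assume "c \<in> modsol p q n" "d \<in> modsol p q n"
        and eq: "pre (- (sval p q c div 2 ^ n)) @ c = pre (- (sval p q d div 2 ^ n)) @ d"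
      then have "length c = length d" by (simp add: modsol_def)
      with eq show "c = d" by simp
    qed
    show "(\<lambda>c. pre (- (sval p q c div 2 ^ n)) @ c) ` modsol p q n \<subseteq> sol p q (n + L)"
    proof clarify
      fix c assume c: "c \<in> modsol p q n"
      from pre[OF k[OF c]] c show "pre (- (sval p q c div 2 ^ n)) @ c \<in> sol p q (n + L)"
        by (auto simp: sol_def modsol_def word_value_append)
    qed
  qed
  then show thesis by (rule that)
qed

section \<open>Growth rates and the pressure\<close>

lemma ln_card_convergent:
  fixes S :: "nat \<Rightarrow> 'a list set"
  assumes A: "finite A" and sub: "\<And>n. S n \<subseteq> words A n" and ne: "\<And>n. S n \<noteq> {}"
    and app: "\<And>m n u v. u \<in> S m \<Longrightarrow> v \<in> S n \<Longrightarrow> u @ v \<in> S (m + n)"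
  shows "convergent (\<lambda>n. ln (real (card (S n))) / real n)"
proof (rule superadditive_convergent[where C = "ln (real (card A))"])
  have fin: "finite (S n)" for n by (rule finite_subset[OF sub finite_words[OF A]])
  have len: "length u = n" if "u \<in> S n" for u n using that sub[of n] by auto
  have pos: "card (S n) \<ge> 1" for n using fin[of n] ne[of n] by (simp add: Suc_leI card_gt_0_iff)
  show "0 \<le> ln (real (card (S n)))" for n using pos[of n] by simp
  show "ln (real (card (S m))) + ln (real (card (S n))) \<le> ln (real (card (S (m + n))))" for m n
  proof -
    \<comment> \<open>Concatenation is injective because the length of the first factor is fixed;
      this makes the cardinalities supermultiplicative.\<close>
    have "card (S m \<times> S n) \<le> card (S (m + n))"
    proof (rule card_inj_on_le[OF _ _ fin])
      show "inj_on (\<lambda>(u, v). u @ v) (S m \<times> S n)"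
      proof (rule inj_onI)
        fix x y assume "x \<in> S m \<times> S n" "y \<in> S m \<times> S n"
          "(\<lambda>(u, v). u @ v) x = (\<lambda>(u, v). u @ v) y"
        then show "x = y"
          using len[of "fst x" m] len[of "fst y" m] by (cases x, cases y) simp
      qed
    qed (use app in auto)
    then have "real (card (S m)) * real (card (S n)) \<le> real (card (S (m + n)))"
      by (simp add: card_cartesian_product flip: of_nat_mult)
    then have "ln (real (card (S m)) * real (card (S n))) \<le> ln (real (card (S (m + n))))"
      using pos[of m] pos[of n] by (intro ln_mono) auto
    then show ?thesis using pos[of m] pos[of n] by (subst (asm) ln_mult_pos) auto
  qed
  show "ln (real (card (S n))) \<le> ln (real (card A)) * real n" for n
  proof -
    have "card (S n) \<le> card A ^ n"
      using card_mono[OF finite_words[OF A] sub, of n] by (simp add: card_words[OF A])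
    then have "ln (real (card (S n))) \<le> ln (real (card A) ^ n)"
      using pos[of n] by (intro ln_mono) (auto simp flip: of_nat_power)
    also have "\<dots> = ln (real (card A)) * real n"
    proof (cases "n = 0")
      case False
      then have "card A > 0" using \<open>card (S n) \<le> card A ^ n\<close> pos[of n]
        by (cases "card A") (auto simp: power_0_left)
      then show ?thesis by (simp add: ln_realpow)
    qed simp
    finally show ?thesis .
  qed
qed

lemma sol_append: "u \<in> sol p q m \<Longrightarrow> v \<in> sol p q n \<Longrightarrow> u @ v \<in> sol p q (m + n)"
  by (auto simp: sol_def word_value_append)

lemma sol_nonempty: "sol p q n \<noteq> {}"
proof -
  have "replicate n (0, 0) \<in> sol p q n" by (auto simp: sol_def syms_def)
  then show ?thesis by blast
qed

lemma ln_card_sol_convergent: "convergent (\<lambda>n. ln (real (card (sol p q n))) / real n)"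
  by (rule ln_card_convergent[where S = "sol p q", OF finite_syms _ sol_nonempty sol_append]) (auto simp: sol_def)

text \<open>Up to a factor 3, \<open>Zpart\<close> lies between the solution counts for lengths
  \<open>n\<close> and \<open>n + L\<close>; neither the factor nor the fixed shift affects the
  exponential growth rate.\<close>

lemma pressure_limit:
  assumes "coprime p q" "q > 0" "p \<le> q"
    and lim: "(\<lambda>n. ln (real (card (sol p q n))) / real n) \<longlonglongrightarrow> l"
  shows "pressure p q = l"
proof -
  let ?M = "\<lambda>n. ln (real (card (sol p q n)))"
  obtain L where L: "\<And>n. card (modsol p q n) \<le> card (sol p q (n + L))"
    using card_modsol_le_sol[OF assms(1-3)] by blast
  have pos: "card (sol p q n) > 0" for n
    by (simp add: card_gt_0_iff finite_sol sol_nonempty)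
  have lower: "?M n - ln 3 \<le> ln (Zpart p q n)" for n
  proof -
    have "real (card (sol p q n)) / 3 \<le> Zpart p q n"
      using Zpart_bounds(1)[of p q n] card_sol_le_modsol[of p q n]
      by (simp add: sum_Qprod_eq_card assms)
    then have "ln (real (card (sol p q n)) / 3) \<le> ln (Zpart p q n)"
      using pos[of n] by (intro ln_mono) auto
    then show ?thesis using pos[of n] by (simp add: ln_divide_pos)
  qed
  have upper: "ln (Zpart p q n) \<le> ?M (n + L) + ln 3" for n
  proof -
    have "0 < Zpart p q n"
      using Zpart_bounds(1)[of p q n] card_sol_le_modsol[of p q n] pos[of n]
      by (simp add: sum_Qprod_eq_card assms)
    moreover have "Zpart p q n \<le> 3 * real (card (sol p q (n + L)))"
      using Zpart_bounds(2)[of p q n] L[of n]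
      by (simp add: sum_Qprod_eq_card assms)
    ultimately have "ln (Zpart p q n) \<le> ln (3 * real (card (sol p q (n + L))))"
      by (intro ln_mono) auto
    then show ?thesis using pos[of "n + L"] by (simp add: ln_mult_pos)
  qed
  have "(\<lambda>n. ln (Zpart p q n) / real n) \<longlonglongrightarrow> l"
  proof (rule tendsto_sandwich)
    show "\<forall>\<^sub>F n in sequentially. ?M n / real n - ln 3 / real n \<le> ln (Zpart p q n) / real n"
      using lower by (intro always_eventually allI) (simp add: divide_right_mono flip: diff_divide_distrib)
    show "\<forall>\<^sub>F n in sequentially. ln (Zpart p q n) / real n
        \<le> ?M (n + L) / real (n + L) * (1 + real L / real n) + ln 3 / real n"
      using eventually_gt_at_top[of 0]
    proof eventually_elim
      case (elim n)
      \<comment> \<open>The correction factor replaces the denominator \<open>n + L\<close> of the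
        shifted sequence by \<open>n\<close> and tends to 1.\<close>
      have "?M (n + L) / real (n + L) * (1 + real L / real n) = ?M (n + L) / real n"
        using elim by (simp add: divide_simps)
      then show ?case
        using upper[of n] elim by (simp add: divide_right_mono flip: add_divide_distrib)
    qed
    show "(\<lambda>n. ?M n / real n - ln 3 / real n) \<longlonglongrightarrow> l"
      using tendsto_diff[OF lim lim_const_over_n[of "ln 3"]] by simp
    have "(\<lambda>n. ?M (n + L) / real (n + L)) \<longlonglongrightarrow> l"
      using lim by (rule LIMSEQ_ignore_initial_segment)
    then have "(\<lambda>n. ?M (n + L) / real (n + L) * (1 + real L / real n) + ln 3 / real n)
        \<longlonglongrightarrow> l * (1 + 0) + 0"
      by (intro tendsto_intros lim_const_over_n)
    then show "(\<lambda>n. ?M (n + L) / real (n + L) * (1 + real L / real n) + ln 3 / real n)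
        \<longlonglongrightarrow> l" by simp
  qed
  then show ?thesis unfolding pressure_def by (rule limI)
qed

section \<open>Coinciding compositions\<close>

text \<open>The two words are zipped into one word over pairs, so that
  \<open>ln_card_convergent\<close> applies.\<close>

definition coincidences :: "real set \<Rightarrow> nat \<Rightarrow> (real \<times> real) list set" where
  "coincidences D n = {c \<in> words (D \<times> D) n. Fcomp (map fst c) = Fcomp (map snd c)}"

lemma Ncount_eq_card: "Ncount D n = card (coincidences D n)"
proof -
  have "bij_betw (\<lambda>c. (map fst c, map snd c)) (coincidences D n)
    {(a, b). a \<in> words D n \<and> b \<in> words D n \<and> Fcomp a = Fcomp b}"
  proof (rule bij_betw_byWitness[where f' = "\<lambda>(a, b). zip a b"])
    show "(\<lambda>(a, b). zip a b) ` {(a, b). a \<in> words D n \<and> b \<in> words D n \<and> Fcomp a = Fcomp b}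
       \<subseteq> coincidences D n"
      by (auto simp: coincidences_def dest: set_zip_leftD set_zip_rightD)
  qed (auto simp: coincidences_def zip_map_fst_snd, blast+)
  then show ?thesis unfolding Ncount_def by (simp add: bij_betw_same_card)
qed

lemma Fcomp_Nil [simp]: "Fcomp [] = id"
  by (simp add: Fcomp_def)

lemma Fcomp_Cons [simp]: "Fcomp (i # a) = Fmap i \<circ> Fcomp a"
  by (simp add: Fcomp_def)

lemma Fcomp_append: "Fcomp (a @ b) = Fcomp a \<circ> Fcomp b"
  by (induction a) (simp_all add: comp_assoc)

lemma ln_Ncount_convergent:
  assumes "finite D" "D \<noteq> {}"
  shows "convergent (\<lambda>n. ln (real (Ncount D n)) / real n)"
  unfolding Ncount_eq_card
proof (rule ln_card_convergent)
  show "finite (D \<times> D)" using assms by simp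
  show "coincidences D n \<noteq> {}" for n
  proof -
    obtain x where "x \<in> D" using assms by blast
    then have "replicate n (x, x) \<in> coincidences D n"
      by (auto simp: coincidences_def)
    then show ?thesis by blast
  qed
qed (auto simp: coincidences_def Fcomp_append)

text \<open>If \<open>p / q\<close> equals 0 or 1 it receives the symbol 0 or 1. The map thus stays
  injective on the digit set but may miss the symbol 2, which is why the counts are compared by an
  inequality.\<close>

definition digit_sym :: "real \<Rightarrow> nat" where
  "digit_sym i = (if i = 0 then 0 else if i = 1 then 1 else 2)"

definition sym_num :: "nat \<Rightarrow> nat \<Rightarrow> nat \<Rightarrow> int" where
  "sym_num p q s = (if s = 1 then int q else if s = 2 then int p else 0)"

text \<open>Evaluating at 0 and clearing the denominators turns an equality of compositions into one
  of integers.\<close>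

lemma Fcomp_word_value:
  assumes "set a \<subseteq> digitset p q" "q > 0"
  shows "real q * 2 ^ length a * Fcomp a 0 = word_value (\<lambda>i. sym_num p q (digit_sym i)) a"
  using assms(1)
proof (induction a)
  case (Cons i a)
  have e: "real q * i = sym_num p q (digit_sym i)"
    using Cons.prems assms(2) by (auto simp: digitset_def sym_num_def digit_sym_def)
  have "real q * 2 ^ length (i # a) * Fcomp (i # a) 0
      = real q * i * 2 ^ length a + real q * 2 ^ length a * Fcomp a 0"
    by (simp add: Fmap_def field_simps)
  then show ?case using Cons e by simp
qed simp

lemma Ncount_le_card_sol:
  assumes "q > 0"
  shows "Ncount (digitset p q) n \<le> card (sol p q n)"
  unfolding Ncount_eq_card
proof (rule card_inj_on_le[where f = "map (map_prod digit_sym digit_sym)", OF _ _ finite_sol])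
  have "inj_on digit_sym (digitset p q)"
    by (auto simp: inj_on_def digit_sym_def digitset_def split: if_splits)
  then have "inj_on (map_prod digit_sym digit_sym) (digitset p q \<times> digitset p q)"
    by (intro map_prod_inj_on)
  then have "inj_on (map (map_prod digit_sym digit_sym)) (lists (digitset p q \<times> digitset p q))"
    by (rule inj_on_map_lists)
  then show "inj_on (map (map_prod digit_sym digit_sym)) (coincidences (digitset p q) n)"
    by (rule inj_on_subset) (auto simp: coincidences_def)
  show "map (map_prod digit_sym digit_sym) ` coincidences (digitset p q) n \<subseteq> sol p q n"
  proof clarify
    fix c assume c: "c \<in> coincidences (digitset p q) n"
    let ?e = "\<lambda>i. sym_num p q (digit_sym i)"
    have "set (map fst c) \<subseteq> digitset p q" "set (map snd c) \<subseteq> digitset p q"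
      using c by (auto simp: coincidences_def)
    from this[THEN Fcomp_word_value, OF assms] c
    have "real_of_int (word_value ?e (map fst c)) = real_of_int (word_value ?e (map snd c))"
      by (auto simp: coincidences_def)
    \<comment> \<open>The coefficients 1 give the difference the shape of
      \<open>word_value_lincomb\<close>.\<close>
    then have "word_value (\<lambda>d. 1 * ?e (fst d) - 1 * ?e (snd d)) c = 0"
      unfolding word_value_lincomb by (simp add: word_value_map)
    moreover have "int q * dy (map_prod digit_sym digit_sym d) - int p * dx (map_prod digit_sym digit_sym d)
        = 1 * ?e (fst d) - 1 * ?e (snd d)" for d
      by (cases d) (simp add: sym_num_def)
    ultimately have "sval p q (map (map_prod digit_sym digit_sym) c) = 0"
      by (simp only: word_value_map)
    then show "map (map_prod digit_sym digit_sym) c \<in> sol p q n"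
      using c by (auto simp: sol_def coincidences_def syms_def digit_sym_def)
  qed
qed

theorem theorem4p2:
  fixes p q :: nat
  assumes "coprime p q" and "q > 0" and "p \<le> q"
  shows "Nexp (digitset p q) \<le> pressure p q"
proof -
  have D: "finite (digitset p q)" "digitset p q \<noteq> {}" by (simp_all add: digitset_def)
  have lim: "(\<lambda>n. ln (real (Ncount (digitset p q) n)) / real n) \<longlonglongrightarrow> Nexp (digitset p q)"
    unfolding Nexp_def using ln_Ncount_convergent[OF D] by (rule convergent_LIMSEQ_iff[THEN iffD1])
  obtain l where l: "(\<lambda>n. ln (real (card (sol p q n))) / real n) \<longlonglongrightarrow> l"
    using ln_card_sol_convergent by (auto simp: convergent_def)
  have "ln (real (Ncount (digitset p q) n)) / real n \<le> ln (real (card (sol p q n))) / real n" for n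
  proof (cases "Ncount (digitset p q) n = 0")
    case True
    \<comment> \<open>With the convention \<open>ln 0 = 0\<close> the left side is 0, while the
      right side is nonnegative as \<open>sol\<close> is nonempty.\<close>
    have "card (sol p q n) > 0" by (simp add: card_gt_0_iff finite_sol sol_nonempty)
    then show ?thesis using True by simp
  next
    case False
    then show ?thesis
      using Ncount_le_card_sol[OF assms(2), of p n] by (intro divide_right_mono ln_mono) auto
  qed
  then have "Nexp (digitset p q) \<le> l"
    using LIMSEQ_le[OF lim l] by blast
  then show ?thesis using pressure_limit[OF assms l] by simp
qed

end
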